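(* For every finite undirected simple graph $G$ and every prime power $q$, $$M(G)\le\mathbb{CAP}_q(G)\le VC(G)\le 2M(G),$$ where $M(G)$ is the maximum size of a matching in $G$ and $VC(G)$ is the minimum size of a vertex cover of $G$.
   Context: Let $G$ have vertex set $V=\{1,\dots,n\}$ and, for $i\in V$, let $N(i)$ be the set of neighbours of $i$. For $X\in\mathbb{F}_q^n$ and $I\subseteq V$, $X_I\in\mathbb{F}_q^{|I|}$ denotes the projection onto the coordinates in $I$. An RDSS (recoverable distributed storage system) code for $G$ is a set $\mathcal{C}\subseteq\mathbb{F}_q^n$ for which there are deterministic functions $f_i:\mathbb{F}_q^{|N(i)|}\to\mathbb{F}_q$, $i=1,\dots,n$, with $X_i=f_i(X_{N(i)})$ for all $X\in\mathcal{C}$ and all $i$. Its dimension is $\log_q|\mathcal{C}|$. $\mathbb{CAP}_q(G)$ denotes the maximum dimension of an RDSS code over $\mathbb{F}_q$ for $G$. A matching is a set of edges no two of which share a vertex; a vertex cover is a set of vertices containing at least one endpoint of every edge. *)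

theory Defs
  imports
    Complex_Main
    "HOL-Library.FuncSet"
    "HOL-Algebra.Ring"
    "HOL-Number_Theory.Prime_Powers"
    "Graph_Theory.Pair_Digraph"
begin

text \<open>
  A finite simple undirected graph is a finite, symmetric, loop-free digraph without parallel
  arcs (locale \<^locale>\<open>pair_graph\<close>); each undirected edge is a pair of opposite arcs, so
  edges are counted as two-element vertex sets.
\<close>

definition uedges :: "'a pair_pre_digraph \<Rightarrow> 'a set set" where
  "uedges G = {{u, v} | u v. (u, v) \<in> parcs G}"

definition nbrs :: "'a pair_pre_digraph \<Rightarrow> 'a \<Rightarrow> 'a set" where
  "nbrs G i = {j. (i, j) \<in> parcs G}"

definition is_matching :: "'a pair_pre_digraph \<Rightarrow> 'a set set \<Rightarrow> bool" where
  "is_matching G M \<longleftrightarrow> M \<subseteq> uedges G \<and> (\<forall>e\<in>M. \<forall>e'\<in>M. e \<noteq> e' \<longrightarrow> e \<inter> e' = {})"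

definition is_vertex_cover :: "'a pair_pre_digraph \<Rightarrow> 'a set \<Rightarrow> bool" where
  "is_vertex_cover G S \<longleftrightarrow> S \<subseteq> pverts G \<and> (\<forall>e\<in>uedges G. e \<inter> S \<noteq> {})"

definition matching_number :: "'a pair_pre_digraph \<Rightarrow> nat" where
  "matching_number G = Max {card M | M. is_matching G M}"

definition vertex_cover_number :: "'a pair_pre_digraph \<Rightarrow> nat" where
  "vertex_cover_number G = Min {card S | S. is_vertex_cover G S}"

text \<open>
  Words over the alphabet \<open>carrier F\<close> with coordinates in \<open>I\<close> are the extensional functions
  \<open>I \<rightarrow>\<^sub>E carrier F\<close>, and \<open>restrict X I\<close> is the projection of \<open>X\<close> onto \<open>I\<close>. Recovery functions
  are total on all words over the neighbourhood, whether or not these occur in the code.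
\<close>

definition is_rdss_code ::
    "('f, 'm) ring_scheme \<Rightarrow> 'a pair_pre_digraph \<Rightarrow> ('a \<Rightarrow> 'f) set \<Rightarrow> bool" where
  "is_rdss_code F G C \<longleftrightarrow>
     C \<subseteq> (pverts G \<rightarrow>\<^sub>E carrier F) \<and>
     (\<exists>f. \<forall>i\<in>pverts G.
        f i \<in> (nbrs G i \<rightarrow>\<^sub>E carrier F) \<rightarrow> carrier F \<and>
        (\<forall>X\<in>C. X i = f i (restrict X (nbrs G i))))"

definition code_dim :: "('f, 'm) ring_scheme \<Rightarrow> ('a \<Rightarrow> 'f) set \<Rightarrow> real" where
  "code_dim F C = log (real (card (carrier F))) (real (card C))"

text \<open>
  The empty code has no dimension, so it is left out of the maximum.
\<close>

definition rdss_capacity :: "('f, 'm) ring_scheme \<Rightarrow> 'a pair_pre_digraph \<Rightarrow> real" where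
  "rdss_capacity F G = Max {code_dim F C | C. is_rdss_code F G C \<and> C \<noteq> {}}"

text \<open>All three extrema range over finite nonempty sets.\<close>

lemma (in pair_graph) finite_uedges: "finite (uedges G)"
proof -
  have "uedges G = (\<lambda>(u, v). {u, v}) ` parcs G"
    by (auto simp: uedges_def)
  then show ?thesis
    using pair_finite_arcs by simp
qed

lemma (in pair_graph) matching_sizes:
  "finite {card M | M. is_matching G M}" "{card M | M. is_matching G M} \<noteq> {}"
proof -
  have "{card M | M. is_matching G M} \<subseteq> card ` Pow (uedges G)"
    by (auto simp: is_matching_def)
  then show "finite {card M | M. is_matching G M}"
    using finite_uedges by (meson finite_Pow_iff finite_imageI finite_subset)
  have "is_matching G {}"
    by (simp add: is_matching_def)
  then show "{card M | M. is_matching G M} \<noteq> {}"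
    by blast
qed

lemma (in pair_graph) vertex_cover_sizes:
  "finite {card S | S. is_vertex_cover G S}" "{card S | S. is_vertex_cover G S} \<noteq> {}"
proof -
  have "{card S | S. is_vertex_cover G S} \<subseteq> card ` Pow (pverts G)"
    by (auto simp: is_vertex_cover_def)
  then show "finite {card S | S. is_vertex_cover G S}"
    using pair_finite_verts by (meson finite_Pow_iff finite_imageI finite_subset)
  have "is_vertex_cover G (pverts G)"
    by (auto simp: is_vertex_cover_def uedges_def dest: in_arcsD1)
  then show "{card S | S. is_vertex_cover G S} \<noteq> {}"
    by blast
qed

lemma (in pair_graph) rdss_code_dims:
  assumes "finite (carrier F)" and "carrier F \<noteq> {}"
  shows "finite {code_dim F C | C. is_rdss_code F G C \<and> C \<noteq> {}}"
    and "{code_dim F C | C. is_rdss_code F G C \<and> C \<noteq> {}} \<noteq> {}"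
proof -
  let ?W = "pverts G \<rightarrow>\<^sub>E carrier F"
  have "finite ?W"
    using assms(1) pair_finite_verts by (simp add: finite_PiE)
  moreover have "{code_dim F C | C. is_rdss_code F G C \<and> C \<noteq> {}} \<subseteq> code_dim F ` Pow ?W"
    unfolding is_rdss_code_def by blast
  ultimately show "finite {code_dim F C | C. is_rdss_code F G C \<and> C \<noteq> {}}"
    by (meson finite_Pow_iff finite_imageI finite_subset)
  obtain a where a: "a \<in> carrier F"
    using assms(2) by blast
  have "is_rdss_code F G {restrict (\<lambda>_. a) (pverts G)}"
    unfolding is_rdss_code_def using a
    by (intro conjI exI[of _ "\<lambda>_ _. a"]) auto
  then show "{code_dim F C | C. is_rdss_code F G C \<and> C \<noteq> {}} \<noteq> {}"
    by blast
qed

end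

theory Submission
  imports Defs
begin

text \<open>
  Repeating one free symbol on both ends of every edge of a matching gives a code of dimension
  the size of the matching. The neighbours of a vertex outside a vertex cover all lie in the
  cover, so a codeword is determined by its projection onto the cover. The vertices covered by a
  maximum matching form a vertex cover.
\<close>

lemma is_vertex_cover_nbrs_subset:
  assumes "is_vertex_cover G S" and "i \<notin> S"
  shows "nbrs G i \<subseteq> S"
proof
  fix j
  assume "j \<in> nbrs G i"
  then have "{i, j} \<in> uedges G"
    by (auto simp: nbrs_def uedges_def)
  with assms show "j \<in> S"
    by (auto simp: is_vertex_cover_def)
qed

text \<open>At a vertex outside \<open>S\<close> the recovery function reads only coordinates in
  \<open>S\<close>. Two codewords agreeing on \<open>S\<close> therefore feed it the same input and
  agree there too.\<close>

lemma rdss_code_inj_on_vertex_cover: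
  assumes C: "is_rdss_code F G C" and S: "is_vertex_cover G S"
  shows "inj_on (\<lambda>X. restrict X S) C"
proof (rule inj_onI)
  fix X Y
  assume X: "X \<in> C" and Y: "Y \<in> C" and eq: "restrict X S = restrict Y S"
  have agree: "X i = Y i" if "i \<in> S" for i
    using fun_cong[OF eq, of i] that by simp
  from C obtain f where f: "Z i = f i (restrict Z (nbrs G i))"
    if "i \<in> pverts G" "Z \<in> C" for i Z
    unfolding is_rdss_code_def by blast
  have "X i = Y i" if i: "i \<in> pverts G" for i
  proof (cases "i \<in> S")
    case False
    have "restrict X (nbrs G i) = restrict Y (nbrs G i)"
      using is_vertex_cover_nbrs_subset[OF S False] agree by (intro restrict_ext) blast
    then show ?thesis
      using f[OF i X] f[OF i Y] by simp
  qed (rule agree)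
  moreover have "X \<in> pverts G \<rightarrow>\<^sub>E carrier F" "Y \<in> pverts G \<rightarrow>\<^sub>E carrier F"
    using C X Y by (auto simp: is_rdss_code_def)
  ultimately show "X = Y"
    by (rule PiE_ext[rotated 2])
qed

text \<open>Injectivity of the projection onto \<open>S\<close> bounds \<open>card C\<close> by the
  number of words over \<open>S\<close>, which is \<open>card (carrier F) ^ card S\<close>; then
  take logarithms.\<close>

lemma (in pair_graph) code_dim_le_vertex_cover:
  assumes C: "is_rdss_code F G C" "C \<noteq> {}" and S: "is_vertex_cover G S"
    and fin: "finite (carrier F)" and q: "card (carrier F) > 1"
  shows "code_dim F C \<le> real (card S)"
proof -
  have SV: "S \<subseteq> pverts G"
    using S by (simp add: is_vertex_cover_def)
  then have finS: "finite S"
    using pair_finite_verts finite_subset by blast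
  have CV: "C \<subseteq> pverts G \<rightarrow>\<^sub>E carrier F"
    using C by (simp add: is_rdss_code_def)
  then have "finite C"
    using fin pair_finite_verts by (meson finite_PiE finite_subset)
  \<comment> \<open>This is where \<open>C \<noteq> {}\<close> enters: the logarithm is monotone
    only on positive arguments.\<close>
  then have pos: "card C > 0"
    using C by (simp add: card_gt_0_iff)
  have "(\<lambda>X. restrict X S) ` C \<subseteq> S \<rightarrow>\<^sub>E carrier F"
    using CV SV by fastforce
  then have "card C \<le> card (S \<rightarrow>\<^sub>E carrier F)"
    using rdss_code_inj_on_vertex_cover[OF C(1) S] fin finS by (intro card_inj_on_le finite_PiE)
  also have "\<dots> = card (carrier F) ^ card S"
    using finS by (simp add: card_PiE)
  finally have "real (card C) \<le> real (card (carrier F)) ^ card S"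
    by (metis of_nat_le_iff of_nat_power)
  then have "log (card (carrier F)) (card C) \<le> log (card (carrier F)) (real (card (carrier F)) ^ card S)"
    using q pos by (intro log_mono) auto
  also have "\<dots> = card S"
    using q by (simp add: log_nat_power)
  finally show ?thesis
    by (simp add: code_dim_def)
qed

text \<open>Codewords are indexed by arbitrary words \<open>y\<close> over \<open>M\<close>. Both
  ends of an edge \<open>e\<close> store \<open>y e\<close>, so each end recovers its symbol by
  copying the other.\<close>

lemma (in pair_graph) matching_code:
  assumes M: "is_matching G M" and fin: "finite (carrier F)" and q: "card (carrier F) > 1"
  obtains C where "is_rdss_code F G C" "C \<noteq> {}" "code_dim F C = real (card M)"
proof -
  obtain a where a: "a \<in> carrier F"
    using q by fastforce
  have ME: "M \<subseteq> uedges G" and disj: "\<And>e e'. e \<in> M \<Longrightarrow> e' \<in> M \<Longrightarrow> e \<noteq> e' \<Longrightarrow> e \<inter> e' = {}"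
    using M by (auto simp: is_matching_def)
  have finM: "finite M"
    using ME finite_uedges finite_subset by blast
  \<comment> \<open>Meaningful only for \<open>v \<in> \<Union>M\<close>, where disjointness of the
    edges of \<open>M\<close> gives uniqueness.\<close>
  define edge where "edge v = (THE e. e \<in> M \<and> v \<in> e)" for v
  have edge: "edge v = e" if "e \<in> M" "v \<in> e" for v e
    unfolding edge_def using that disj by (intro the_equality) auto
  have "\<exists>j. j \<in> nbrs G i \<and> {i, j} \<in> M" if "i \<in> \<Union>M" for i
  proof -
    obtain e where e: "e \<in> M" "i \<in> e"
      using \<open>i \<in> \<Union>M\<close> by blast
    then obtain u v where "e = {u, v}" "(u, v) \<in> parcs G"
      using ME by (auto simp: uedges_def)
    moreover from this have "(v, u) \<in> parcs G"
      using arcs_symmetric by blast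
    ultimately show ?thesis
      using e by (auto simp: nbrs_def insert_commute)
  qed
  then obtain mate where mate: "\<And>i. i \<in> \<Union>M \<Longrightarrow> mate i \<in> nbrs G i \<and> {i, mate i} \<in> M"
    by metis
  have nbrs_verts: "nbrs G i \<subseteq> pverts G" for i
    by (auto simp: nbrs_def dest: in_arcsD2)
  \<comment> \<open>Unmatched vertices hold the fixed symbol \<open>a\<close>, which a constant
    recovery function returns.\<close>
  define word where
    "word y = restrict (\<lambda>v. if v \<in> \<Union>M then y (edge v) else a) (pverts G)" for y
  let ?C = "word ` (M \<rightarrow>\<^sub>E carrier F)"
  define f where "f i w = (if i \<in> \<Union>M then w (mate i) else a)" for i and w :: "'a \<Rightarrow> 'b"
  have edge_M: "edge v \<in> M" if "v \<in> \<Union>M" for v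
    using that edge by blast
  have "is_rdss_code F G ?C"
    unfolding is_rdss_code_def
  proof (intro conjI exI[of _ f] ballI)
    show "?C \<subseteq> pverts G \<rightarrow>\<^sub>E carrier F"
      using a edge_M by (auto simp: word_def PiE_iff)
  next
    fix i
    \<comment> \<open>For every word \<open>w\<close> over the neighbourhood, codeword or not,
      \<open>w (mate i)\<close> is a symbol because \<open>mate i\<close> is a neighbour of
      \<open>i\<close>.\<close>
    show "f i \<in> (nbrs G i \<rightarrow>\<^sub>E carrier F) \<rightarrow> carrier F"
      using a mate unfolding f_def by (fastforce simp: PiE_iff)
  next
    fix i X
    assume i: "i \<in> pverts G" and "X \<in> ?C"
    then obtain y where X: "X = word y"
      by blast
    show "X i = f i (restrict X (nbrs G i))"
    proof (cases "i \<in> \<Union>M")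
      case True
      with mate have m: "mate i \<in> nbrs G i" "{i, mate i} \<in> M"
        by auto
      \<comment> \<open>Both vertices lie on the matching edge \<open>{i, mate i}\<close>, hence
        store the same symbol.\<close>
      then have "edge i = edge (mate i)" "mate i \<in> \<Union>M" "mate i \<in> pverts G"
        using edge[OF m(2)] nbrs_verts by auto
      then show ?thesis
        using True m(1) i by (simp add: X f_def word_def)
    qed (simp add: X f_def word_def i)
  qed
  moreover have "?C \<noteq> {}"
    using a by (auto simp: PiE_eq_empty_iff)
  moreover have "inj_on word (M \<rightarrow>\<^sub>E carrier F)"
  proof (rule inj_onI)
    fix y z
    assume y: "y \<in> M \<rightarrow>\<^sub>E carrier F" and z: "z \<in> M \<rightarrow>\<^sub>E carrier F" and eq: "word y = word z"
    \<comment> \<open>The symbol at \<open>e\<close> can be read off the codeword at any endpoint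
      \<open>u\<close> of \<open>e\<close>.\<close>
    have "y e = z e" if e: "e \<in> M" for e
    proof -
      have "e \<in> uedges G"
        using e ME by blast
      then obtain u where u: "u \<in> e" "u \<in> pverts G"
        unfolding uedges_def using in_arcsD1 by blast
      then show ?thesis
        using fun_cong[OF eq, of u] e edge[OF e u(1)] by (auto simp: word_def split: if_splits)
    qed
    then show "y = z"
      by (rule PiE_ext[OF y z])
  qed
  then have "card ?C = card (carrier F) ^ card M"
    using finM by (simp add: card_image card_PiE)
  then have "code_dim F ?C = real (card M)"
    using q by (simp add: code_dim_def log_nat_power)
  ultimately show thesis
    by (rule that)
qed

text \<open>An edge missing every vertex of \<open>\<Union>M\<close> could be added to
  \<open>M\<close>, giving a larger matching.\<close>

lemma (in pair_graph) max_matching_vertex_cover: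
  assumes M: "is_matching G M" and max: "\<And>M'. is_matching G M' \<Longrightarrow> card M' \<le> card M"
  shows "is_vertex_cover G (\<Union>M)"
  unfolding is_vertex_cover_def
proof (intro conjI ballI)
  show "\<Union>M \<subseteq> pverts G"
    using M by (fastforce simp: is_matching_def uedges_def dest: in_arcsD1 in_arcsD2)
next
  fix e
  assume e: "e \<in> uedges G"
  show "e \<inter> \<Union>M \<noteq> {}"
  proof
    assume d: "e \<inter> \<Union>M = {}"
    \<comment> \<open>Without this, disjointness from \<open>\<Union>M\<close> would not exclude
      \<open>e \<in> M\<close>, and the insertion might not increase the cardinality.\<close>
    have "e \<noteq> {}"
      using e by (auto simp: uedges_def)
    with d have "e \<notin> M"
      by blast
    moreover have "finite M"
      using M finite_uedges finite_subset by (auto simp: is_matching_def)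
    moreover have "is_matching G (insert e M)"
      using M e d unfolding is_matching_def by blast
    then have "card (insert e M) \<le> card M"
      by (rule max)
    ultimately show False
      by simp
  qed
qed

text \<open>The source of the factor 2: it bounds the cover formed by the vertices of a maximum
  matching.\<close>

lemma (in pair_graph) card_Union_matching_le:
  assumes "is_matching G M"
  shows "card (\<Union>M) \<le> 2 * card M"
proof -
  have "card e \<le> 2" if "e \<in> M" for e
    using that assms by (auto simp: is_matching_def uedges_def card_insert_if)
  then have "(\<Sum>e\<in>M. card e) \<le> 2 * card M"
    using sum_bounded_above[of M card 2] by (simp add: mult.commute)
  moreover have "card (\<Union>M) \<le> (\<Sum>e\<in>M. card e)"
    by (rule card_Union_le_sum_card)
  ultimately show ?thesis
    by linarith
qed

theorem mainTheorem8:
  fixes G :: "'a pair_pre_digraph"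
    and F :: "('f, 'm) ring_scheme"
    and q :: nat
  assumes "pair_graph G"
    and "primepow q"
    and "field F"
    and "finite (carrier F)"
    and "card (carrier F) = q"
  shows "real (matching_number G) \<le> rdss_capacity F G
       \<and> rdss_capacity F G \<le> real (vertex_cover_number G)
       \<and> vertex_cover_number G \<le> 2 * matching_number G"
proof -
  interpret pair_graph G
    by fact
  \<comment> \<open>The base of the logarithm must exceed 1, which holds for every prime
    power.\<close>
  have q: "card (carrier F) > 1"
    using assms(2,5) primepow_gt_Suc_0 by auto
  then have ne: "carrier F \<noteq> {}"
    by auto
  note dims = rdss_code_dims[OF assms(4) ne]
  obtain M where M: "is_matching G M" "card M = matching_number G"
    using Max_in[OF matching_sizes] unfolding matching_number_def by auto
  have max: "card M' \<le> card M" if "is_matching G M'" for M'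
    using Max_ge[OF matching_sizes(1)] that M(2) unfolding matching_number_def by auto
  obtain S where S: "is_vertex_cover G S" "card S = vertex_cover_number G"
    using Min_in[OF vertex_cover_sizes] unfolding vertex_cover_number_def by auto
  obtain C where C: "is_rdss_code F G C" "C \<noteq> {}" "code_dim F C = real (card M)"
    using matching_code[OF M(1) assms(4) q] .
  have "real (matching_number G) \<le> rdss_capacity F G"
    using C Max_ge[OF dims(1)] unfolding rdss_capacity_def M(2) by force
  moreover have "rdss_capacity F G \<le> real (vertex_cover_number G)"
    \<comment> \<open>Every nonempty code obeys the bound for the one minimum cover
      \<open>S\<close>, hence so does the maximum.\<close>
    unfolding rdss_capacity_def S(2)[symmetric]
    using code_dim_le_vertex_cover[OF _ _ S(1) assms(4) q] by (intro Max.boundedI dims) auto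
  moreover have "vertex_cover_number G \<le> card (\<Union>M)"
    unfolding vertex_cover_number_def
    using max_matching_vertex_cover[OF M(1) max] by (intro Min_le vertex_cover_sizes) auto
  then have "vertex_cover_number G \<le> 2 * matching_number G"
    using card_Union_matching_le[OF M(1)] M(2) by linarith
  ultimately show ?thesis
    by blast
qed

end
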